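(* Any algorithm that, on every instance of the Maximum Matrix Contraction problem, returns a maximal feasible solution is a $2\sqrt{n}$-approximation algorithm, where $n$ is the number of entries equal to $1$ in the input matrix. That is, for every binary matrix $M$ with $n$ ones and every maximal feasible solution $(I,J)$ for $M$, the optimal density $d^*=\max\{d(C(M,I',J')) : (I',J')\text{ feasible}\}$ satisfies $d^*\le 2\sqrt{n}\cdot d(C(M,I,J))$.
   Context: A binary matrix has entries in $\{0,1\}$. For a $p\times q$ binary matrix $M$ and $i\in\{1,\dots,p-1\}$, the line contraction matrix $L_i$ is the $p\times p$ matrix whose row $k$ has a single $1$ in column $k$ for $k<i$, whose row $i$ has $1$s exactly in columns $i$ and $i+1$, whose row $k$ has a single $1$ in column $k+1$ for $i<k\le p-1$, and whose last row is zero. For $j\in\{1,\dots,q-1\}$, the column contraction matrix $C_j$ is the $q\times q$ matrix whose row $k$ has a single $1$ in column $k$ for $k\le j$, whose row $j+1$ has a single $1$ in column $j$, whose row $k$ has a single $1$ in column $k-1$ for $k>j+1$, and whose last column is zero. For sorted sublists $I=[i_1<\dots<i_{|I|}]$ of $[1,\dots,p-1]$ and $J=[j_1<\dots<j_{|J|}]$ of $[1,\dots,q-1]$, $C(M,I,J)=L_{i_1}\cdots L_{i_{|I|}}\cdot M\cdot C_{j_{|J|}}\cdots C_{j_1}$. A pair $(I,J)$ is a feasible solution if $C(M,I,J)$ is a binary matrix; it is maximal if there is no feasible $(I',J')\neq(I,J)$ with $I\subseteq I'$, $J\subseteq J'$. The density $d(A)$ of a binary matrix $A$ is the number of unordered pairs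 of distinct $1$-entries at positions $(i,j),(i',j')$ with $\max(|i-i'|,|j-j'|)=1$. The Maximum Matrix Contraction problem asks for a feasible solution maximizing $d(C(M,I,J))$. *)

theory Defs
  imports Complex_Main "Jordan_Normal_Form.Matrix"
begin

text \<open>
  Matrices are indexed from 0 in the library, whereas lines, columns and contraction indices are
  numbered from 1 in the mathematics. Contraction indices keep their 1-based numbering, and the
  two contraction matrices are described through the 1-based position \<open>(k, l)\<close>.
\<close>

definition line_contraction_mat :: "nat \<Rightarrow> nat \<Rightarrow> nat mat" where
  "line_contraction_mat p i = mat p p (\<lambda>(r, c). let k = r + 1; l = c + 1 in
     of_bool (k < i \<and> l = k \<or>
              k = i \<and> (l = i \<or> l = i + 1) \<or>
              i < k \<and> k \<le> p - 1 \<and> l = k + 1))"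

definition column_contraction_mat :: "nat \<Rightarrow> nat \<Rightarrow> nat mat" where
  "column_contraction_mat q j = mat q q (\<lambda>(r, c). let k = r + 1; l = c + 1 in
     of_bool (k \<le> j \<and> l = k \<or>
              k = j + 1 \<and> l = j \<or>
              k > j + 1 \<and> l = k - 1))"

text \<open>
  For \<open>I = {i\<^sub>1 < \<dots> < i\<^sub>s}\<close> and \<open>J = {j\<^sub>1 < \<dots> < j\<^sub>t}\<close> this is
  \<open>L\<^bsub>i\<^sub>1\<^esub> \<cdots> L\<^bsub>i\<^sub>s\<^esub> M C\<^bsub>j\<^sub>t\<^esub> \<cdots> C\<^bsub>j\<^sub>1\<^esub>\<close>: the largest indices are contracted first.
\<close>

definition contraction :: "nat mat \<Rightarrow> nat set \<Rightarrow> nat set \<Rightarrow> nat mat" where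
  "contraction M I J =
     foldr (\<lambda>j A. A * column_contraction_mat (dim_col M) j) (sorted_list_of_set J)
       (foldr (\<lambda>i A. line_contraction_mat (dim_row M) i * A) (sorted_list_of_set I) M)"

definition binary_mat :: "nat mat \<Rightarrow> bool" where
  "binary_mat A \<longleftrightarrow> elements_mat A \<subseteq> {0, 1}"

definition feasible :: "nat mat \<Rightarrow> nat set \<Rightarrow> nat set \<Rightarrow> bool" where
  "feasible M I J \<longleftrightarrow> I \<subseteq> {1..dim_row M - 1} \<and> J \<subseteq> {1..dim_col M - 1} \<and>
     binary_mat (contraction M I J)"

definition maximal_feasible :: "nat mat \<Rightarrow> nat set \<Rightarrow> nat set \<Rightarrow> bool" where
  "maximal_feasible M I J \<longleftrightarrow> feasible M I J \<and>
     \<not> (\<exists>I' J'. feasible M I' J' \<and> (I', J') \<noteq> (I, J) \<and> I \<subseteq> I' \<and> J \<subseteq> J')"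

definition ones :: "nat mat \<Rightarrow> (nat \<times> nat) set" where
  "ones A = {(i, j). i < dim_row A \<and> j < dim_col A \<and> A $$ (i, j) = 1}"

definition density :: "nat mat \<Rightarrow> nat" where
  "density A = card {{(i, j), (i', j')} | i j i' j'.
     (i, j) \<in> ones A \<and> (i', j') \<in> ones A \<and>
     max \<bar>int i - int i'\<bar> \<bar>int j - int j'\<bar> = 1}"

definition optimal_density :: "nat mat \<Rightarrow> nat" where
  "optimal_density M = Max {density (contraction M I J) | I J. feasible M I J}"

text \<open>
  The maximum above is over a finite nonempty set whenever \<open>M\<close> is binary.
\<close>

lemma contraction_empty [simp]: "contraction M {} {} = M"
  by (simp add: contraction_def)

lemma feasible_empty: "binary_mat M \<Longrightarrow> feasible M {} {}"
  by (simp add: feasible_def)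

lemma finite_feasible: "finite {(I, J). feasible M I J}"
  by (rule finite_subset[of _ "Pow {1..dim_row M - 1} \<times> Pow {1..dim_col M - 1}"])
    (auto simp: feasible_def)

lemma finite_feasible_densities: "finite {density (contraction M I J) | I J. feasible M I J}"
proof -
  have "{density (contraction M I J) | I J. feasible M I J}
      = (\<lambda>(I, J). density (contraction M I J)) ` {(I, J). feasible M I J}"
    by auto
  then show ?thesis
    using finite_feasible by simp
qed

text \<open>
  An algorithm is the function from instances (binary matrices) to solutions that it computes;
  running times play no role. Its ratio may depend on the instance.
\<close>

definition approximation_algorithm ::
    "(nat mat \<Rightarrow> nat set \<times> nat set) \<Rightarrow> (nat mat \<Rightarrow> real) \<Rightarrow> bool" where
  "approximation_algorithm alg \<rho> \<longleftrightarrow> (\<forall>M. binary_mat M \<longrightarrow>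
     (case alg M of (I, J) \<Rightarrow> feasible M I J \<and>
        real (optimal_density M) \<le> \<rho> M * real (density (contraction M I J))))"

end

theory Submission imports Defs begin

text \<open>
  Contracting moves the ones of \<open>M\<close>, and a solution is feasible iff no two of them collide; so a
  feasible solution keeps the number \<open>n\<close> of ones. A set of \<open>n\<close> grid points has at most
  \<open>n - k\<close> adjacent pairs in each of the four king directions, where \<open>k\<close> is the number of lines
  in that direction that meet the set. Rows times columns is at least \<open>n\<close>, and so is diagonals
  times antidiagonals; by AM-GM the optimum is at most \<open>4 n - 4 sqrt n\<close>. In a maximal solution with
  \<open>p'\<close> rows and \<open>q'\<close> columns left, any two consecutive lines would collide, which gives
  \<open>p' - 1\<close> vertical and \<open>q' - 1\<close> horizontal adjacent pairs; as \<open>p' q' \<ge> n\<close>, the density is at least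
  \<open>2 sqrt n - 2\<close>. Finally \<open>4 n - 4 sqrt n = 2 sqrt n (2 sqrt n - 2)\<close>.
\<close>

section \<open>Contraction matrices as matrices of index maps\<close>

text \<open>Matrix of the linear map that sends the \<open>r\<close>-th unit vector to the
  \<open>f r\<close>-th: multiplying by it on the left adds line \<open>r\<close> onto line
  \<open>f r\<close>.\<close>

definition merge_mat :: "nat \<Rightarrow> (nat \<Rightarrow> nat) \<Rightarrow> nat mat" where
  "merge_mat p f = mat p p (\<lambda>(a, r). of_bool (f r = a))"

text \<open>
  The 0-based line \<open>r\<close> is moved up once for every contracted index in \<open>{1..r}\<close>.
\<close>

definition merge_index :: "nat set \<Rightarrow> nat \<Rightarrow> nat" where
  "merge_index I r = card ({1..r} - I)"

lemma merge_mat_carrier [simp]: "merge_mat p f \<in> carrier_mat p p"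
  by (simp add: merge_mat_def)

lemma merge_mat_id: "merge_mat p id = 1\<^sub>m p"
  by (rule eq_matI) (auto simp: merge_mat_def)

text \<open>If \<open>g r\<close> left the range, column \<open>r\<close> of the second factor would
  vanish although \<open>f (g r)\<close> could be a valid index; hence the assumption.\<close>

lemma merge_mat_mult:
  assumes "\<And>r. r < p \<Longrightarrow> g r < p"
  shows "merge_mat p f * merge_mat p g = merge_mat p (f \<circ> g)"
proof (rule eq_matI)
  fix a r
  assume "a < dim_row (merge_mat p (f \<circ> g))" "r < dim_col (merge_mat p (f \<circ> g))"
  then have a: "a < p" and r: "r < p"
    by (simp_all add: merge_mat_def)
  have "(merge_mat p f * merge_mat p g) $$ (a, r)
      = (\<Sum>s = 0..<p. of_bool (f s = a) * of_bool (g r = s))"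
    using a r by (simp add: merge_mat_def scalar_prod_def)
  also have "\<dots> = (\<Sum>s = 0..<p. if s = g r then of_bool (f s = a) else 0)"
    by (rule sum.cong) auto
  also have "\<dots> = merge_mat p (f \<circ> g) $$ (a, r)"
    using a r assms[OF r] by (simp add: merge_mat_def)
  finally show "(merge_mat p f * merge_mat p g) $$ (a, r) = merge_mat p (f \<circ> g) $$ (a, r)" .
qed (simp_all add: merge_mat_def)

lemma merge_index_le: "merge_index I r \<le> r"
  unfolding merge_index_def by (metis Diff_subset card_atLeastAtMost card_mono diff_Suc_1 finite_atLeastAtMost)

lemma merge_index_0 [simp]: "merge_index I 0 = 0"
  by (simp add: merge_index_def)

lemma merge_index_Suc: "merge_index I (Suc r) = merge_index I r + of_bool (Suc r \<notin> I)"
proof -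
  have "{1..Suc r} - I = ({1..r} - I) \<union> ({Suc r} - I)"
    by auto
  moreover have "card (({1..r} - I) \<union> ({Suc r} - I)) = card ({1..r} - I) + card ({Suc r} - I)"
    by (rule card_Un_disjoint) auto
  moreover have "card ({Suc r} - I) = of_bool (Suc r \<notin> I)"
    by (simp add: insert_Diff_if)
  ultimately show ?thesis
    by (simp add: merge_index_def)
qed

lemma merge_index_mono: "r \<le> s \<Longrightarrow> merge_index I r \<le> merge_index I s"
  unfolding merge_index_def by (intro card_mono) auto

lemma merge_index_empty: "merge_index {} r = r"
  by (simp add: merge_index_def)

text \<open>Contracting \<open>t\<close> as well moves up by one exactly the lines from
  \<open>t\<close> on. The additive form avoids truncated subtraction.\<close>

lemma merge_index_insert:
  assumes "1 \<le> t" "t \<notin> I"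
  shows "merge_index I r = merge_index (insert t I) r + of_bool (t \<le> r)"
  using assms by (induction r) (auto simp: merge_index_Suc le_Suc_eq)

text \<open>Contracting indices above \<open>i\<close> fixes every line up to \<open>i\<close> and
  moves no later line below \<open>i\<close>, so contracting \<open>i\<close> afterwards still acts
  at the original place. This is why the largest indices come first.\<close>

lemma merge_index_singleton_comp:
  assumes "1 \<le> i" "\<And>x. x \<in> X \<Longrightarrow> i < x"
  shows "merge_index {i} (merge_index X r) = merge_index (insert i X) r"
proof (induction r)
  case (Suc r)
  have small: "merge_index X s = s" if "s \<le> i" for s
    using that assms(2) by (induction s) (force simp: merge_index_Suc)+
  have large: "i \<le> merge_index X s" if "i \<le> s" for s
    using merge_index_mono[OF that, of X] small[of i] by simp
  show ?case
    using Suc small[of r] large[of r] assms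
    by (cases "Suc r \<le> i") (auto simp: merge_index_Suc)
qed simp

lemma line_contraction_mat_eq:
  assumes "i \<in> {1..p - 1}"
  shows "line_contraction_mat p i = merge_mat p (merge_index {i})"
proof -
  \<comment> \<open>In 0-based numbering the lines \<open>i - 1\<close> and \<open>i\<close> meet in
    line \<open>i - 1\<close>.\<close>
  have *: "merge_index {i} r = (if r < i then r else r - 1)" for r
    using assms by (induction r) (auto simp: merge_index_Suc)
  show ?thesis
    using assms
    by (intro eq_matI) (auto simp: line_contraction_mat_def merge_mat_def * Let_def)
qed

lemma column_contraction_mat_eq:
  assumes "j \<in> {1..q - 1}"
  shows "column_contraction_mat q j = transpose_mat (merge_mat q (merge_index {j}))"
proof -
  have *: "merge_index {j} r = (if r < j then r else r - 1)" for r
    using assms by (induction r) (auto simp: merge_index_Suc)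
  show ?thesis
    using assms
    by (intro eq_matI) (auto simp: column_contraction_mat_def merge_mat_def * Let_def)
qed

lemma merge_mat_Cons:
  assumes "sorted_wrt (<) (i # xs)" "1 \<le> i"
  shows "merge_mat p (merge_index {i}) * merge_mat p (merge_index (set xs))
    = merge_mat p (merge_index (set (i # xs)))"
proof -
  have "merge_mat p (merge_index {i}) * merge_mat p (merge_index (set xs))
      = merge_mat p (merge_index {i} \<circ> merge_index (set xs))"
    by (rule merge_mat_mult) (meson le_less_trans merge_index_le)
  then show ?thesis
    using assms merge_index_singleton_comp[of i "set xs"] by (simp add: comp_def)
qed

lemma foldr_line_contraction:
  assumes "sorted_wrt (<) xs" "set xs \<subseteq> {1..p - 1}" "M \<in> carrier_mat p q"
  shows "foldr (\<lambda>i A. line_contraction_mat p i * A) xs M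
    = merge_mat p (merge_index (set xs)) * M"
  using assms
proof (induction xs)
  case Nil
  then show ?case
    by (simp add: merge_index_empty[abs_def] merge_mat_id[unfolded id_def])
next
  case (Cons i xs)
  then have "foldr (\<lambda>i A. line_contraction_mat p i * A) (i # xs) M
      = merge_mat p (merge_index {i}) * (merge_mat p (merge_index (set xs)) * M)"
    by (simp add: line_contraction_mat_eq)
  also have "\<dots> = merge_mat p (merge_index {i}) * merge_mat p (merge_index (set xs)) * M"
    using Cons.prems(3)
    by (intro assoc_mult_mat[OF merge_mat_carrier merge_mat_carrier, symmetric])
  also have "\<dots> = merge_mat p (merge_index (set (i # xs))) * M"
    using Cons.prems by (subst merge_mat_Cons) auto
  finally show ?case .
qed

lemma foldr_column_contraction:
  assumes "sorted_wrt (<) xs" "set xs \<subseteq> {1..q - 1}" "M \<in> carrier_mat p q"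
  shows "foldr (\<lambda>j A. A * column_contraction_mat q j) xs M
    = M * transpose_mat (merge_mat q (merge_index (set xs)))"
  using assms
proof (induction xs)
  case Nil
  then show ?case
    by (simp add: merge_index_empty[abs_def] merge_mat_id[unfolded id_def])
next
  case (Cons i xs)
  let ?A = "merge_mat q (merge_index {i})" and ?B = "merge_mat q (merge_index (set xs))"
  from Cons have "foldr (\<lambda>j A. A * column_contraction_mat q j) (i # xs) M
      = M * transpose_mat ?B * transpose_mat ?A"
    by (simp add: column_contraction_mat_eq)
  also have "\<dots> = M * (transpose_mat ?B * transpose_mat ?A)"
    using Cons.prems(3) by (intro assoc_mult_mat[where ?n\<^sub>1.0 = p and ?n\<^sub>2.0 = q and ?n\<^sub>4.0 = q and ?n\<^sub>3.0 = q]) auto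
  \<comment> \<open>Transposition reverses the product, so the smallest index becomes the left
    factor, as \<open>merge_mat_Cons\<close> requires.\<close>
  also have "transpose_mat ?B * transpose_mat ?A = transpose_mat (?A * ?B)"
    by (rule transpose_mult[OF merge_mat_carrier merge_mat_carrier, symmetric])
  also have "?A * ?B = merge_mat q (merge_index (set (i # xs)))"
    using Cons.prems by (intro merge_mat_Cons) auto
  finally show ?case .
qed

section \<open>Feasibility as injectivity on the ones\<close>

definition merge_pos :: "nat set \<Rightarrow> nat set \<Rightarrow> nat \<times> nat \<Rightarrow> nat \<times> nat" where
  "merge_pos I J = map_prod (merge_index I) (merge_index J)"

text \<open>Puts the column coordinate first, the form in which \<open>merge_collision\<close> is
  applied to columns.\<close>

lemma inj_on_merge_pos_swap:
  "inj_on (merge_pos I J) S \<longleftrightarrow>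
    inj_on (\<lambda>x. (merge_index J (snd x), merge_index I (fst x))) S"
  by (simp add: inj_on_def merge_pos_def map_prod_def case_prod_unfold conj_commute)

lemma finite_ones [simp]: "finite (ones A)"
  by (rule finite_subset[of _ "{..<dim_row A} \<times> {..<dim_col A}"]) (auto simp: ones_def)

lemma binary_mat_iff:
  "binary_mat A \<longleftrightarrow> (\<forall>a<dim_row A. \<forall>b<dim_col A. A $$ (a, b) \<le> 1)"
  unfolding binary_mat_def elements_mat_def by (force simp: le_Suc_eq)

lemma contraction_eq:
  assumes "I \<subseteq> {1..dim_row M - 1}" "J \<subseteq> {1..dim_col M - 1}"
  shows "contraction M I J = merge_mat (dim_row M) (merge_index I) * M *
    transpose_mat (merge_mat (dim_col M) (merge_index J))"
proof -
  have "finite I" "finite J"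
    using assms finite_subset by blast+
  then show ?thesis
    using assms unfolding contraction_def
    by (subst foldr_line_contraction[where q = "dim_col M"], simp_all,
        subst foldr_column_contraction[where p = "dim_row M"], simp_all)
       (auto intro!: mult_carrier_mat)
qed

lemma dim_contraction:
  assumes "I \<subseteq> {1..dim_row M - 1}" "J \<subseteq> {1..dim_col M - 1}"
  shows "dim_row (contraction M I J) = dim_row M" "dim_col (contraction M I J) = dim_col M"
  by (simp_all add: contraction_eq[OF assms] merge_mat_def)

text \<open>Both products sum over fibres of the index maps, and for binary \<open>M\<close> such a
  sum counts ones.\<close>

lemma contraction_entry:
  assumes "I \<subseteq> {1..dim_row M - 1}" "J \<subseteq> {1..dim_col M - 1}" "binary_mat M"
    and "a < dim_row M" "b < dim_col M"
  shows "contraction M I J $$ (a, b) = card {x \<in> ones M. merge_pos I J x = (a, b)}"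
proof -
  let ?p = "dim_row M" and ?q = "dim_col M" and ?f = "merge_index I" and ?g = "merge_index J"
  have "contraction M I J $$ (a, b)
      = (\<Sum>c = 0..<?q. (\<Sum>r = 0..<?p. of_bool (?f r = a) * M $$ (r, c)) * of_bool (?g c = b))"
    using assms(4,5)
    by (simp add: contraction_eq[OF assms(1,2)] merge_mat_def scalar_prod_def)
  also have "\<dots> = (\<Sum>c = 0..<?q. \<Sum>r = 0..<?p.
      of_bool (?f r = a \<and> ?g c = b \<and> (r, c) \<in> ones M))"
    unfolding sum_distrib_right
  proof (intro sum.cong refl)
    fix c r
    assume "c \<in> {0..<?q}" "r \<in> {0..<?p}"
    moreover from this have "M $$ (r, c) = 0 \<or> M $$ (r, c) = 1"
      using assms(3) by (auto simp: binary_mat_iff le_Suc_eq)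
    ultimately show "of_bool (?f r = a) * M $$ (r, c) * of_bool (?g c = b)
        = of_bool (?f r = a \<and> ?g c = b \<and> (r, c) \<in> ones M)"
      by (auto simp: ones_def)
  qed
  also have "\<dots> = (\<Sum>x \<in> {0..<?p} \<times> {0..<?q}. of_bool (merge_pos I J x = (a, b) \<and> x \<in> ones M))"
    by (subst sum.swap, subst sum.cartesian_product, intro sum.cong refl)
       (auto simp: merge_pos_def)
  also have "\<dots> = card ({0..<?p} \<times> {0..<?q} \<inter> {x. merge_pos I J x = (a, b) \<and> x \<in> ones M})"
    by (subst sum_of_bool_eq) simp_all
  also have "{0..<?p} \<times> {0..<?q} \<inter> {x. merge_pos I J x = (a, b) \<and> x \<in> ones M}
      = {x \<in> ones M. merge_pos I J x = (a, b)}"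
    by (auto simp: ones_def)
  finally show ?thesis .
qed

lemma merge_pos_bounds:
  assumes "x \<in> ones M"
  shows "fst (merge_pos I J x) < dim_row M" "snd (merge_pos I J x) < dim_col M"
  using assms le_less_trans[OF merge_index_le] by (auto simp: merge_pos_def ones_def)

text \<open>Entries are sizes of fibres of \<open>merge_pos I J\<close>, and a map is injective iff
  its fibres have at most one element. By \<open>merge_pos_bounds\<close>, each nonempty fibre lies
  over a position of the matrix.\<close>

lemma feasible_iff:
  assumes "binary_mat M"
  shows "feasible M I J \<longleftrightarrow> I \<subseteq> {1..dim_row M - 1} \<and> J \<subseteq> {1..dim_col M - 1} \<and>
    inj_on (merge_pos I J) (ones M)"
proof (cases "I \<subseteq> {1..dim_row M - 1} \<and> J \<subseteq> {1..dim_col M - 1}")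
  case True
  then have IJ: "I \<subseteq> {1..dim_row M - 1}" "J \<subseteq> {1..dim_col M - 1}"
    by auto
  have "binary_mat (contraction M I J) \<longleftrightarrow>
      (\<forall>a<dim_row M. \<forall>b<dim_col M. card {x \<in> ones M. merge_pos I J x = (a, b)} \<le> 1)"
    by (simp add: binary_mat_iff dim_contraction[OF IJ] contraction_entry[OF IJ assms])
  also have "\<dots> \<longleftrightarrow> inj_on (merge_pos I J) (ones M)"
  proof
    assume L: "\<forall>a<dim_row M. \<forall>b<dim_col M. card {x \<in> ones M. merge_pos I J x = (a, b)} \<le> 1"
    show "inj_on (merge_pos I J) (ones M)"
    proof (rule inj_onI)
      fix x y
      assume xy: "x \<in> ones M" "y \<in> ones M" "merge_pos I J x = merge_pos I J y"
      obtain a b where ab: "merge_pos I J x = (a, b)"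
        by fastforce
      then have "card {z \<in> ones M. merge_pos I J z = (a, b)} \<le> Suc 0"
        using L merge_pos_bounds[OF xy(1), of I J] by simp
      then have "\<forall>z\<in>{z \<in> ones M. merge_pos I J z = (a, b)}.
          \<forall>z'\<in>{z \<in> ones M. merge_pos I J z = (a, b)}. z = z'"
        by (subst (asm) card_le_Suc0_iff_eq) simp_all
      from this[rule_format, of x y] show "x = y"
        using xy ab by simp
    qed
  qed (auto simp: card_le_Suc0_iff_eq inj_on_def)
  finally show ?thesis
    using IJ by (simp add: feasible_def)
qed (auto simp: feasible_def)

lemma ones_contraction:
  assumes "binary_mat M" "feasible M I J"
  shows "ones (contraction M I J) = merge_pos I J ` ones M"
proof -
  have IJ: "I \<subseteq> {1..dim_row M - 1}" "J \<subseteq> {1..dim_col M - 1}"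
    and inj: "inj_on (merge_pos I J) (ones M)"
    using assms feasible_iff by blast+
  have "card {x \<in> ones M. merge_pos I J x = y} = 1 \<longleftrightarrow> y \<in> merge_pos I J ` ones M" for y
    using inj by (auto simp: card_1_singleton_iff inj_on_def)
  moreover have "y \<in> ones (contraction M I J) \<longleftrightarrow> fst y < dim_row M \<and> snd y < dim_col M \<and>
      card {x \<in> ones M. merge_pos I J x = y} = 1" for y
    by (cases y)
       (auto simp: ones_def[of "contraction M I J"] dim_contraction[OF IJ]
         contraction_entry[OF IJ assms(1)])
  ultimately show ?thesis
    using merge_pos_bounds[of _ M I J] by blast
qed

section \<open>Counting adjacent pairs\<close>

text \<open>Edges are unordered, so the same notion serves the symmetric \<open>king\<close> and the
  oriented successor relations.\<close>

definition edges :: "('a \<Rightarrow> 'a \<Rightarrow> bool) \<Rightarrow> 'a set \<Rightarrow> 'a set set" where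
  "edges R S = {{x, y} | x y. x \<in> S \<and> y \<in> S \<and> R x y}"

lemma finite_edges [simp]: "finite S \<Longrightarrow> finite (edges R S)"
  by (rule finite_subset[of _ "Pow S"]) (auto simp: edges_def)

text \<open>
  If the successor relation \<open>R\<close> moves along the fibres of \<open>k\<close>, the last point of each fibre has no
  successor.
\<close>

lemma card_edges_le:
  fixes m :: "'a \<Rightarrow> nat"
  assumes "finite S"
    and R: "\<And>x y. R x y \<Longrightarrow> k x = k y \<and> m x < m y"
    and func: "\<And>x y z. R x y \<Longrightarrow> R x z \<Longrightarrow> y = z"
  shows "card (edges R S) + card (k ` S) \<le> card S"
proof -
  define T where "T = {x \<in> S. \<exists>y\<in>S. R x y}"
  \<comment> \<open>Successors are unique, so an edge is determined by its lower endpoint, which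
    lies in \<open>T\<close>.\<close>
  have "edges R S \<subseteq> (\<lambda>x. {x, THE y. R x y}) ` T"
  proof
    fix e
    assume "e \<in> edges R S"
    then obtain x y where xy: "e = {x, y}" "x \<in> S" "y \<in> S" "R x y"
      by (auto simp: edges_def)
    then have "(THE y. R x y) = y"
      using func by blast
    with xy show "e \<in> (\<lambda>x. {x, THE y. R x y}) ` T"
      by (auto simp: T_def)
  qed
  then have 1: "card (edges R S) \<le> card T"
    using assms(1) by (intro surj_card_le) (auto simp: T_def)
  have "k ` S \<subseteq> k ` (S - T)"
  proof
    fix v
    assume "v \<in> k ` S"
    then have ne: "{x \<in> S. k x = v} \<noteq> {}"
      by auto
    obtain x where x: "x \<in> {x \<in> S. k x = v}" "m x = Max (m ` {x \<in> S. k x = v})"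
      using Max_in[of "m ` {x \<in> S. k x = v}"] ne assms(1) by fastforce
    have "x \<notin> T"
    proof
      assume "x \<in> T"
      then obtain y where "y \<in> S" "R x y"
        by (auto simp: T_def)
      then have "y \<in> {x \<in> S. k x = v}" "m x < m y"
        using R x by fastforce+
      then show False
        using x(2) assms(1) Max_ge[of "m ` {x \<in> S. k x = v}" "m y"] by fastforce
    qed
    then show "v \<in> k ` (S - T)"
      using x(1) by auto
  qed
  then have "card (k ` S) \<le> card (S - T)"
    using assms(1) by (intro surj_card_le) auto
  also have "\<dots> = card S - card T"
    using assms(1) by (intro card_Diff_subset) (auto simp: T_def)
  finally show ?thesis
    using 1 card_mono[OF assms(1), of T] by (auto simp: T_def)
qed

text \<open>Label each edge by the larger value of \<open>\<pi>\<close> on it, attained at the upper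
  endpoint. Every \<open>f t\<close> occurs as a label, and distinct labels need distinct
  edges.\<close>

lemma card_le_card_edges:
  fixes \<pi> :: "'a \<Rightarrow> nat"
  assumes "finite S" "inj_on f G"
    and R: "\<And>x y. R x y \<Longrightarrow> \<pi> x < \<pi> y"
    and ex: "\<And>t. t \<in> G \<Longrightarrow> \<exists>x\<in>S. \<exists>y\<in>S. R x y \<and> \<pi> y = f t"
  shows "card G \<le> card (edges R S)"
proof -
  have "f ` G \<subseteq> (\<lambda>e. Max (\<pi> ` e)) ` edges R S"
  proof
    fix v
    assume "v \<in> f ` G"
    then obtain x y where xy: "x \<in> S" "y \<in> S" "R x y" "\<pi> y = v"
      using ex by blast
    then have "Max (\<pi> ` {x, y}) = v"
      using R[of x y] by (simp add: max_def)
    moreover have "{x, y} \<in> edges R S"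
      using xy by (auto simp: edges_def)
    ultimately show "v \<in> (\<lambda>e. Max (\<pi> ` e)) ` edges R S"
      by (metis imageI)
  qed
  then have "card (f ` G) \<le> card (edges R S)"
    using assms(1) by (intro surj_card_le) auto
  then show ?thesis
    using assms(2) by (simp add: card_image)
qed

section \<open>King directions and the upper bound\<close>

text \<open>Each of the four directions gets one orientation, along which the row (for
  \<open>horiz\<close>, the column) increases; this is the measure \<open>m\<close> for
  \<open>card_edges_le\<close>.\<close>

definition vert :: "nat \<times> nat \<Rightarrow> nat \<times> nat \<Rightarrow> bool" where
  "vert x y \<longleftrightarrow> fst y = Suc (fst x) \<and> snd y = snd x"

definition horiz :: "nat \<times> nat \<Rightarrow> nat \<times> nat \<Rightarrow> bool" where
  "horiz x y \<longleftrightarrow> fst y = fst x \<and> snd y = Suc (snd x)"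

definition diag :: "nat \<times> nat \<Rightarrow> nat \<times> nat \<Rightarrow> bool" where
  "diag x y \<longleftrightarrow> fst y = Suc (fst x) \<and> snd y = Suc (snd x)"

definition antidiag :: "nat \<times> nat \<Rightarrow> nat \<times> nat \<Rightarrow> bool" where
  "antidiag x y \<longleftrightarrow> fst y = Suc (fst x) \<and> snd x = Suc (snd y)"

lemmas direction_defs = vert_def horiz_def diag_def antidiag_def

definition king :: "nat \<times> nat \<Rightarrow> nat \<times> nat \<Rightarrow> bool" where
  "king x y \<longleftrightarrow> max \<bar>int (fst x) - int (fst y)\<bar> \<bar>int (snd x) - int (snd y)\<bar> = 1"

lemma density_eq: "density A = card (edges king (ones A))"
proof -
  have "{{(i, j), (i', j')} | i j i' j'. (i, j) \<in> ones A \<and> (i', j') \<in> ones A \<and>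
      max \<bar>int i - int i'\<bar> \<bar>int j - int j'\<bar> = 1} = edges king (ones A)"
    by (auto simp: edges_def king_def)
  then show ?thesis
    by (simp add: density_def)
qed

lemma king_cases:
  assumes "king x y"
  obtains "vert x y" | "vert y x" | "horiz x y" | "horiz y x" | "diag x y" | "diag y x"
    | "antidiag x y" | "antidiag y x"
proof -
  have "fst y = Suc (fst x) \<or> fst y = fst x \<or> fst x = Suc (fst y)"
    "snd y = Suc (snd x) \<or> snd y = snd x \<or> snd x = Suc (snd y)"
    "\<not> (fst y = fst x \<and> snd y = snd x)"
    using assms unfolding king_def by linarith+
  then show thesis
    using that unfolding direction_defs by metis
qed

lemma edges_king_subset:
  "edges king S \<subseteq> edges vert S \<union> edges horiz S \<union> edges diag S \<union> edges antidiag S"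
proof
  fix e
  assume "e \<in> edges king S"
  then obtain x y where e: "e = {x, y}" "e = {y, x}" and "x \<in> S" "y \<in> S" "king x y"
    by (auto simp: edges_def)
  from this(5) show "e \<in> edges vert S \<union> edges horiz S \<union> edges diag S \<union> edges antidiag S"
    by (cases rule: king_cases) (use \<open>x \<in> S\<close> \<open>y \<in> S\<close> e in \<open>unfold edges_def, blast+\<close>)
qed

lemma two_sqrt_le_add:
  assumes "n \<le> a * b"
  shows "2 * sqrt (real n) \<le> real a + real b"
proof -
  have "sqrt (real n) \<le> sqrt (real a * real b)"
    using assms by (metis of_nat_le_iff of_nat_mult real_sqrt_le_iff)
  also have "\<dots> \<le> (real a + real b) / 2"
    by (rule arith_geo_mean_sqrt) auto
  finally show ?thesis
    by simp
qed

text \<open>A point is fixed by its lines in the two families \<open>k\<close> and \<open>l\<close>,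
  so the product of the numbers of occupied lines is at least \<open>card S\<close>; AM-GM bounds
  their sum.\<close>

lemma two_sqrt_card_le:
  assumes "finite S" "inj_on (\<lambda>x. (k x, l x)) S"
  shows "2 * sqrt (real (card S)) \<le> real (card (k ` S)) + real (card (l ` S))"
proof -
  have "card S = card ((\<lambda>x. (k x, l x)) ` S)"
    using assms(2) by (simp add: card_image)
  also have "\<dots> \<le> card (k ` S \<times> l ` S)"
    using assms(1) by (intro card_mono) auto
  finally show ?thesis
    by (intro two_sqrt_le_add) (simp add: card_cartesian_product)
qed

lemma card_edges_king_le:
  assumes "finite S"
  shows "real (card (edges king S)) + 4 * sqrt (real (card S)) \<le> 4 * real (card S)"
proof -
  \<comment> \<open>\<open>?d\<close> is constant along diagonals and \<open>?s\<close> along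
    antidiagonals; together they determine the point. The difference may be negative, hence
    \<open>int\<close>.\<close>
  let ?d = "\<lambda>x :: nat \<times> nat. int (fst x) - int (snd x)"
  let ?s = "\<lambda>x :: nat \<times> nat. fst x + snd x"
  have "card (edges king S) \<le>
      card (edges vert S \<union> edges horiz S \<union> edges diag S \<union> edges antidiag S)"
    using assms by (intro card_mono edges_king_subset) auto
  also have "\<dots> \<le> card (edges vert S) + card (edges horiz S) + card (edges diag S)
      + card (edges antidiag S)"
    by (meson add_le_mono1 card_Un_le le_trans)
  finally have 0: "card (edges king S) \<le> \<dots>" .
  have 1: "card (edges vert S) + card (snd ` S) \<le> card S"
    by (rule card_edges_le[where m = fst]) (auto simp: assms vert_def prod_eq_iff)
  have 2: "card (edges horiz S) + card (fst ` S) \<le> card S"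
    by (rule card_edges_le[where m = snd]) (auto simp: assms horiz_def prod_eq_iff)
  have 3: "card (edges diag S) + card (?d ` S) \<le> card S"
    by (rule card_edges_le[where m = fst]) (auto simp: assms diag_def prod_eq_iff)
  have 4: "card (edges antidiag S) + card (?s ` S) \<le> card S"
    by (rule card_edges_le[where m = fst]) (auto simp: assms antidiag_def prod_eq_iff)
  have 5: "2 * sqrt (real (card S)) \<le> real (card (fst ` S)) + real (card (snd ` S))"
    using assms by (intro two_sqrt_card_le) (auto simp: inj_on_def)
  have 6: "2 * sqrt (real (card S)) \<le> real (card (?d ` S)) + real (card (?s ` S))"
    using assms by (intro two_sqrt_card_le) (auto simp: inj_on_def)
  show ?thesis
    using 0 1 2 3 4 5 6 by linarith
qed

section \<open>Collisions in a maximal solution and the lower bound\<close>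

text \<open>Here \<open>\<pi>\<close> is the coordinate being merged and \<open>k\<close> the image
  of the other one. Adding \<open>t\<close> shifts images by at most one, so points that newly
  collide came from opposite sides of \<open>t\<close> and had consecutive images.\<close>

lemma merge_collision:
  assumes t: "1 \<le> t" "t \<notin> I"
    and inj: "inj_on (\<lambda>x. (merge_index I (\<pi> x), k x)) S"
    and ninj: "\<not> inj_on (\<lambda>x. (merge_index (insert t I) (\<pi> x), k x)) S"
  shows "\<exists>x\<in>S. \<exists>y\<in>S. k x = k y \<and> merge_index I (\<pi> y) = Suc (merge_index I (\<pi> x)) \<and>
    merge_index I (\<pi> y) = merge_index I t"
proof -
  let ?f = "merge_index I" and ?f' = "merge_index (insert t I)"
  obtain x y where xy: "x \<in> S" "y \<in> S" "x \<noteq> y" "?f' (\<pi> x) = ?f' (\<pi> y)" "k x = k y"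
    using ninj by (auto simp: inj_on_def)
  have step: "?f (\<pi> w) = Suc (?f (\<pi> v)) \<and> ?f (\<pi> w) = ?f t"
    if "?f' (\<pi> v) = ?f' (\<pi> w)" "?f (\<pi> v) < ?f (\<pi> w)" for v w
  proof -
    have "\<pi> v < t" "t \<le> \<pi> w" "?f (\<pi> w) = Suc (?f (\<pi> v))"
      using that merge_index_insert[OF t, of "\<pi> v"] merge_index_insert[OF t, of "\<pi> w"]
      by (auto split: if_splits simp: of_bool_def)
    \<comment> \<open>Sandwich: \<open>?f t\<close> is at most
      \<open>?f (\<pi> w) = Suc (?f (\<pi> v))\<close>, which is at most
      \<open>Suc (?f (t - 1)) = ?f t\<close>.\<close>
    moreover from this(1,2) have "?f (\<pi> v) \<le> ?f (t - 1)" "?f t \<le> ?f (\<pi> w)"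
      by (intro merge_index_mono; simp)+
    moreover have "?f t = Suc (?f (t - 1))"
      using t merge_index_Suc[of I "t - 1"] by simp
    ultimately show ?thesis
      by simp
  qed
  have "?f (\<pi> x) \<noteq> ?f (\<pi> y)"
    using inj xy by (auto simp: inj_on_def)
  then consider "?f (\<pi> x) < ?f (\<pi> y)" | "?f (\<pi> y) < ?f (\<pi> x)"
    by linarith
  then show ?thesis
    using step xy by cases metis+
qed

text \<open>The step into an uncontracted index is strict. Hence the adjacent pairs found for
  different uncontracted indices are different.\<close>

lemma inj_on_merge_index: "inj_on (merge_index I) ({1..m} - I)"
proof -
  have less: "merge_index I s < merge_index I t" if "s < t" "t \<notin> I" for s t
  proof -
    have "merge_index I s \<le> merge_index I (t - 1)"
      using that by (intro merge_index_mono) simp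
    then show ?thesis
      using that merge_index_Suc[of I "t - 1"] by simp
  qed
  show ?thesis
    by (rule linorder_inj_onI) (use less in fastforce)+
qed

lemma maximal_density_ge:
  assumes M: "binary_mat M" and max: "maximal_feasible M I J"
  shows "2 * sqrt (real (card (ones M))) \<le> real (density (contraction M I J)) + 2"
proof -
  let ?p = "dim_row M" and ?q = "dim_col M"
  define S where "S = ones M"
  define T where "T = merge_pos I J ` S"
  \<comment> \<open>For nonempty \<open>M\<close>, \<open>card P + 1\<close> lines and
    \<open>card Q + 1\<close> columns are left, the extra one being index 0.\<close>
  define P where "P = {1..?p - 1} - I"
  define Q where "Q = {1..?q - 1} - J"
  have feas: "feasible M I J"
    using max by (simp add: maximal_feasible_def)
  then have IJ: "I \<subseteq> {1..?p - 1}" "J \<subseteq> {1..?q - 1}" and inj: "inj_on (merge_pos I J) S"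
    using feasible_iff[OF M] by (auto simp: S_def)
  have fin: "finite T"
    by (simp add: T_def S_def)
  have row: "\<exists>x\<in>T. \<exists>y\<in>T. vert x y \<and> fst y = merge_index I t" if "t \<in> P" for t
  proof -
    \<comment> \<open>Maximality is applied to the extension by the single index
      \<open>t\<close>.\<close>
    have "\<not> feasible M (insert t I) J"
      using max that by (auto simp: maximal_feasible_def P_def)
    then have "\<not> inj_on (merge_pos (insert t I) J) S"
      using that IJ feasible_iff[OF M] by (auto simp: S_def P_def)
    then have "\<exists>x\<in>S. \<exists>y\<in>S. merge_index J (snd x) = merge_index J (snd y) \<and>
        merge_index I (fst y) = Suc (merge_index I (fst x)) \<and>
        merge_index I (fst y) = merge_index I t"
      using inj that by (intro merge_collision) (auto simp: P_def merge_pos_def map_prod_def case_prod_unfold)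
    then obtain x y where "x \<in> S" "y \<in> S"
      "vert (merge_pos I J x) (merge_pos I J y)" "fst (merge_pos I J y) = merge_index I t"
      by (auto simp: merge_pos_def vert_def)
    then show ?thesis
      unfolding T_def by blast
  qed
  have col: "\<exists>x\<in>T. \<exists>y\<in>T. horiz x y \<and> snd y = merge_index J t" if "t \<in> Q" for t
  proof -
    have "\<not> feasible M I (insert t J)"
      using max that by (auto simp: maximal_feasible_def Q_def)
    then have "\<not> inj_on (merge_pos I (insert t J)) S"
      using that IJ feasible_iff[OF M] by (auto simp: S_def Q_def)
    then have "\<exists>x\<in>S. \<exists>y\<in>S. merge_index I (fst x) = merge_index I (fst y) \<and>
        merge_index J (snd y) = Suc (merge_index J (snd x)) \<and>
        merge_index J (snd y) = merge_index J t"
      using inj that by (intro merge_collision) (auto simp: Q_def inj_on_merge_pos_swap)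
    then obtain x y where "x \<in> S" "y \<in> S"
      "horiz (merge_pos I J x) (merge_pos I J y)" "snd (merge_pos I J y) = merge_index J t"
      by (auto simp: merge_pos_def horiz_def)
    then show ?thesis
      unfolding T_def by blast
  qed
  have "card P \<le> card (edges vert T)"
    by (rule card_le_card_edges[where \<pi> = fst, OF fin inj_on_merge_index[of I "?p - 1", folded P_def]])
       (use row in \<open>auto simp: vert_def\<close>)
  moreover have "card Q \<le> card (edges horiz T)"
    by (rule card_le_card_edges[where \<pi> = snd, OF fin inj_on_merge_index[of J "?q - 1", folded Q_def]])
       (use col in \<open>auto simp: horiz_def\<close>)
  \<comment> \<open>No pair is counted twice: a vertical pair shares its column, a horizontal one
    its row.\<close>
  moreover have "card (edges vert T) + card (edges horiz T) = card (edges vert T \<union> edges horiz T)"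
    using fin by (intro card_Un_disjoint[symmetric] finite_edges)
      (auto simp: edges_def vert_def horiz_def doubleton_eq_iff)
  moreover have "card (edges vert T \<union> edges horiz T) \<le> card (edges king T)"
  proof (rule card_mono)
    have "vert x y \<or> horiz x y \<Longrightarrow> king x y" for x y
      by (auto simp: vert_def horiz_def king_def)
    then show "edges vert T \<union> edges horiz T \<subseteq> edges king T"
      unfolding edges_def by blast
  qed (simp add: fin)
  ultimately have dens: "card P + card Q \<le> density (contraction M I J)"
    by (simp add: density_eq ones_contraction[OF M feas] T_def S_def)
  \<comment> \<open>The last line \<open>?p - 1\<close> is moved to \<open>card P\<close>, and
    \<open>merge_index\<close> is monotone; likewise for columns.\<close>
  have "T \<subseteq> {..card P} \<times> {..card Q}"
  proof
    fix y
    assume "y \<in> T"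
    then obtain r c where rc: "r < ?p" "c < ?q" "y = (merge_index I r, merge_index J c)"
      by (auto simp: T_def S_def ones_def merge_pos_def)
    then have "merge_index I r \<le> merge_index I (?p - 1)" "merge_index J c \<le> merge_index J (?q - 1)"
      by (auto intro: merge_index_mono)
    then show "y \<in> {..card P} \<times> {..card Q}"
      using rc by (simp add: merge_index_def P_def Q_def)
  qed
  then have "card T \<le> card ({..card P} \<times> {..card Q})"
    by (intro card_mono) auto
  then have "card S \<le> Suc (card P) * Suc (card Q)"
    using inj by (simp add: T_def card_image card_cartesian_product)
  from two_sqrt_le_add[OF this] show ?thesis
    using dens by (simp add: S_def)
qed

section \<open>The approximation ratio\<close>

text \<open>The maximum is attained, and a feasible contraction keeps the number of ones, so the
  bound for point sets applies to the optimal matrix.\<close>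

lemma optimal_density_le:
  assumes "binary_mat M"
  shows "real (optimal_density M) + 4 * sqrt (real (card (ones M))) \<le> 4 * real (card (ones M))"
proof -
  have "optimal_density M \<in> {density (contraction M I J) | I J. feasible M I J}"
    unfolding optimal_density_def
    using feasible_empty[OF assms] by (intro Max_in finite_feasible_densities) blast
  then obtain I J where IJ: "feasible M I J" "optimal_density M = density (contraction M I J)"
    by blast
  then have "card (ones (contraction M I J)) = card (ones M)"
    using ones_contraction[OF assms] feasible_iff[OF assms] by (simp add: card_image)
  then show ?thesis
    using card_edges_king_le[of "ones (contraction M I J)"] IJ(2) by (simp add: density_eq)
qed

lemma maximal_feasible_ratio:
  assumes "binary_mat M" "maximal_feasible M I J"
  shows "real (optimal_density M) \<le>
    2 * sqrt (real (card (ones M))) * real (density (contraction M I J))"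
proof -
  let ?s = "sqrt (real (card (ones M)))"
  have "real (optimal_density M) \<le> 4 * (?s * ?s) - 4 * ?s"
    using optimal_density_le[OF assms(1)] by simp
  also have "\<dots> = 2 * ?s * (2 * ?s - 2)"
    by (simp add: algebra_simps)
  \<comment> \<open>\<open>2 * ?s - 2\<close> may be negative; monotonicity only asks that the
    factor \<open>2 * ?s\<close> is nonnegative.\<close>
  also have "\<dots> \<le> 2 * ?s * real (density (contraction M I J))"
    using maximal_density_ge[OF assms] by (intro mult_left_mono) auto
  finally show ?thesis .
qed

lemma maximal_feasibleD: "maximal_feasible M I J \<Longrightarrow> feasible M I J"
  by (simp add: maximal_feasible_def)

theorem theorem2:
  "(\<forall>alg. (\<forall>M. binary_mat M \<longrightarrow> (case alg M of (I, J) \<Rightarrow> maximal_feasible M I J)) \<longrightarrow>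
      approximation_algorithm alg (\<lambda>M. 2 * sqrt (real (card (ones M))))) \<and>
   (\<forall>M I J. binary_mat M \<longrightarrow> maximal_feasible M I J \<longrightarrow>
      real (optimal_density M) \<le>
        2 * sqrt (real (card (ones M))) * real (density (contraction M I J)))"
  by (auto simp: approximation_algorithm_def split: prod.splits
    intro: maximal_feasible_ratio dest: maximal_feasibleD)

end
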